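(* Let $n,m\in\mathbb{N}$ and $\mu\in\mathbb{N}_0$. Then $$D(n,-m;\mu)=\sum_{l=0}^{m}\binom{m}{l}(\mu-n)^{m-l}D(1,-l;1)-\sum_{k=2}^{n}\left\{\zeta(k)-1\right\}(k+\mu-n)^m .$$
   Context: $\mathbb{N}=\{1,2,3,\dots\}$, $\mathbb{N}_0=\mathbb{N}\cup\{0\}$, and $\zeta$ is the Riemann zeta function. For $s_1,s_2\in\mathbb{C}$ with $s_1\notin\mathbb{Z}_{\le 0}$ and $\lambda\in\mathbb{C}$ with $\lambda\notin\mathbb{Z}_{<0}$, $$D(s_1,s_2;\lambda):=\sum_{k=1}^{\infty}\frac{\zeta(s_1+k)-1}{(k+\lambda)^{s_2}}.$$ Empty sums are $0$, and $0^0=1$. *)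

theory Defs
  imports "HOL-Complex_Analysis.Complex_Analysis"
begin

definition zeta_series :: "complex \<Rightarrow> complex" where
  "zeta_series s = (\<Sum>j. 1 / of_nat (Suc j) powr s)"

(* The Riemann zeta function: the Dirichlet series on Re s > 1, and elsewhere its
   unique holomorphic continuation to the plane minus the point 1. No meaning is
   attached to the value at the pole s = 1. *)
definition zeta :: "complex \<Rightarrow> complex" where
  "zeta s =
     (if Re s > 1 then zeta_series s
      else (THE c. \<exists>f. f holomorphic_on - {1} \<and>
                       (\<forall>z. Re z > 1 \<longrightarrow> f z = zeta_series z) \<and> f s = c))"

(* Summation over k = 1, 2, 3, ... is rendered through Suc k. The definition is meant for
   s1 not in {0, -1, -2, ...}, so that s1 + k never hits the pole of zeta, and for
   lam not in {-1, -2, ...}, so that the base k + lam is never 0; complex powers are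
   principal values. *)
definition D :: "complex \<Rightarrow> complex \<Rightarrow> complex \<Rightarrow> complex" where
  "D s1 s2 lam =
     (\<Sum>k. (zeta (s1 + of_nat (Suc k)) - 1) / (of_nat (Suc k) + lam) powr s2)"

end

theory Submission
  imports Defs
begin

text \<open>Since \<open>\<zeta>(k) - 1\<close> decays like \<open>2\<^sup>-\<^sup>k\<close>, every series
  \<open>\<Sum>\<^bsub>k\<ge>2\<^esub> (\<zeta>(k) - 1) k\<^sup>l\<close> converges absolutely; it equals \<open>D(1, -l; 1)\<close>.
  Shifting the index by \<open>n\<close> turns \<open>D(n, -m; \<mu>)\<close> into the part \<open>k > n\<close> of
  \<open>\<Sum>\<^bsub>k\<ge>2\<^esub> (\<zeta>(k) - 1) (k + \<mu> - n)\<^sup>m\<close>, which is expanded by the binomial theorem.\<close>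

text \<open>The shift by 2 keeps the argument in the half-plane of convergence, so only the series
  branch of \<open>zeta\<close> is used, never the continuation.\<close>

lemma zeta_of_nat_eq:
  "zeta (of_nat (k + 2)) = (\<Sum>j. 1 / of_nat (Suc j) ^ (k + 2))"
proof -
  have "(of_nat (Suc j) :: complex) powr of_nat (k + 2) = of_nat (Suc j) ^ (k + 2)" for j
    by (rule powr_nat') auto
  then show ?thesis
    by (simp only: zeta_def zeta_series_def) simp
qed

text \<open>Subtracting 1 removes the term \<open>j = 0\<close>. All remaining bases are at least 2,
  so \<open>k\<close> of the \<open>k + 2\<close> factors contribute at most
  \<open>(1 / 2) ^ k\<close>, and the other two leave a convergent sum of inverse squares.\<close>

lemma norm_zeta_of_nat_minus_1_le:
  "norm (zeta (of_nat (k + 2)) - 1) \<le> (\<Sum>j. 1 / real (j + 2) ^ 2) * (1 / 2) ^ k"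
proof -
  let ?f = "\<lambda>j. 1 / (of_nat (Suc j) :: complex) ^ (k + 2)"
  have norm_le: "norm (?f (Suc j)) \<le> 1 / real (j + 2) ^ 2 * (1 / 2) ^ k" for j
  proof -
    have "1 / real (j + 2) ^ k \<le> 1 / 2 ^ k"
      by (intro divide_left_mono power_mono) auto
    then have "1 / real (j + 2) ^ 2 * (1 / real (j + 2) ^ k) \<le> 1 / real (j + 2) ^ 2 * (1 / 2 ^ k)"
      by (intro mult_left_mono) auto
    moreover have "norm (?f (Suc j)) = 1 / real (j + 2) ^ 2 * (1 / real (j + 2) ^ k)"
      by (simp only: norm_divide norm_mult norm_power norm_of_nat norm_one power_add)
        (simp add: mult.commute)
    ultimately show ?thesis
      by (simp add: power_one_over)
  qed
  have squares: "summable (\<lambda>j. 1 / real (j + 2) ^ 2)"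
    using inverse_power_summable[of 2, where ?'a = real]
    by (subst summable_iff_shift) (simp add: inverse_eq_divide)
  then have bound: "summable (\<lambda>j. 1 / real (j + 2) ^ 2 * (1 / 2) ^ k)"
    by (rule summable_mult2)
  have abs_summable: "summable (\<lambda>j. norm (?f (Suc j)))"
    by (rule summable_comparison_test'[OF bound, of 0]) (use norm_le in auto)
  then have "summable ?f"
    using summable_norm_cancel summable_Suc_iff by blast
  then have "zeta (of_nat (k + 2)) - 1 = (\<Sum>j. ?f (Suc j))"
    unfolding zeta_of_nat_eq by (subst suminf_split_head) auto
  then have "norm (zeta (of_nat (k + 2)) - 1) \<le> (\<Sum>j. norm (?f (Suc j)))"
    using summable_norm[OF abs_summable] by simp
  also have "\<dots> \<le> (\<Sum>j. 1 / real (j + 2) ^ 2 * (1 / 2) ^ k)"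
    by (rule suminf_le[OF norm_le abs_summable bound])
  finally show ?thesis
    using suminf_mult2[OF squares] by simp
qed

text \<open>Induction on \<open>l\<close> with \<open>c\<close> split as
  \<open>sqrt c * sqrt c\<close>: one root absorbs the new linear factor, the other goes to the
  induction hypothesis, hence \<open>c\<close> is arbitrary.\<close>

lemma power_bigo_exponential:
  fixes c :: real
  assumes "c > 1"
  shows "(\<lambda>k. real (k + 2) ^ l) \<in> O(\<lambda>k. c ^ k)"
  using assms
proof (induction l arbitrary: c)
  case 0
  then have "1 \<le> c ^ k" for k
    by (intro one_le_power) simp
  then show ?case
    using 0 by (intro bigoI[of _ 1] always_eventually allI) simp
next
  case (Suc l)
  from Suc.prems have gt1: "sqrt c > 1"
    by simp
  define h where "h = sqrt c - 1"
  have h: "h > 0" and sqrt_c: "sqrt c = 1 + h"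
    using gt1 by (simp_all add: h_def)
  \<comment> \<open>The constant makes \<open>(2 + 1 / h) * (1 + k * h)\<close> expand to
    \<open>k + 2\<close> plus nonnegative terms, which is the shape Bernoulli's inequality
    needs.\<close>
  have "real (k + 2) \<le> (2 + 1 / h) * sqrt c ^ k" for k
  proof -
    have "real (k + 2) \<le> (2 + 1 / h) * (1 + real k * h)"
      using h by (simp add: field_simps)
    also have "\<dots> \<le> (2 + 1 / h) * sqrt c ^ k"
      unfolding sqrt_c using h by (intro mult_left_mono Bernoulli_inequality) auto
    finally show ?thesis .
  qed
  then have "(\<lambda>k. real (k + 2)) \<in> O(\<lambda>k. sqrt c ^ k)"
    using gt1 by (intro bigoI[of _ "2 + 1 / h"] always_eventually allI) simp
  from landau_o.big.mult[OF this Suc.IH[OF gt1]]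
  have "(\<lambda>k. real (k + 2) ^ Suc l) \<in> O(\<lambda>k. sqrt c ^ k * sqrt c ^ k)"
    unfolding power_Suc .
  moreover have "sqrt c ^ k * sqrt c ^ k = c ^ k" for k
    using Suc.prems by (subst power_mult_distrib[symmetric]) simp
  ultimately show ?case
    by (simp only:)
qed

text \<open>This justifies exchanging the finite binomial sum with the infinite series.\<close>

lemma summable_zeta_moments:
  "summable (\<lambda>k. (zeta (of_nat (k + 2)) - 1) * of_nat (k + 2) ^ l)"
proof -
  define C where "C = (\<Sum>j. 1 / real (j + 2) ^ 2)"
  \<comment> \<open>Any base strictly between 1 and 2 would serve in place of \<open>3 / 2\<close>:
    its product with \<open>1 / 2\<close> must stay below 1.\<close>
  have "(\<lambda>k. real (k + 2) ^ l * (1 / 2) ^ k) \<in> O(\<lambda>k. (3 / 2) ^ k * (1 / 2) ^ k)"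
    by (intro landau_o.big.mult power_bigo_exponential) auto
  moreover have "(3 / 2 :: real) ^ k * (1 / 2) ^ k = (3 / 4) ^ k" for k
    by (subst power_mult_distrib[symmetric]) simp
  ultimately have "(\<lambda>k. real (k + 2) ^ l * (1 / 2) ^ k) \<in> O(\<lambda>k. (3 / 4) ^ k)"
    by (simp only:)
  moreover have "summable (\<lambda>k. norm ((3 / 4 :: real) ^ k))"
    by (simp add: summable_geometric)
  ultimately have "summable (\<lambda>k. real (k + 2) ^ l * (1 / 2) ^ k)"
    by (rule summable_comparison_test_bigo[rotated])
  then have bound: "summable (\<lambda>k. C * (real (k + 2) ^ l * (1 / 2) ^ k))"
    by (rule summable_mult)
  have "norm ((zeta (of_nat (k + 2)) - 1) * of_nat (k + 2) ^ l)
      \<le> C * (real (k + 2) ^ l * (1 / 2) ^ k)" for k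
  proof -
    have "norm (zeta (of_nat (k + 2)) - 1) * real (k + 2) ^ l
        \<le> C * (1 / 2) ^ k * real (k + 2) ^ l"
      unfolding C_def by (intro mult_right_mono norm_zeta_of_nat_minus_1_le) simp
    then show ?thesis
      by (simp only: norm_mult norm_power norm_of_nat mult_ac)
  qed
  then show ?thesis
    by (rule summable_comparison_test'[OF bound])
qed

text \<open>The base \<open>Suc k + \<mu>\<close> is a positive integer, so the principal power is
  the ordinary one, also for \<open>m = 0\<close>, and dividing by a negative power is
  multiplying.\<close>

lemma D_neg_of_nat:
  "D (of_nat n) (- of_nat m) (of_nat \<mu>) =
     (\<Sum>k. (zeta (of_nat (n + Suc k)) - 1) * of_nat (Suc k + \<mu>) ^ m)"
proof -
  have "(of_nat (Suc k + \<mu>) :: complex) powr (- of_nat m) = 1 / of_nat (Suc k + \<mu>) ^ m" for k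
  proof -
    have "(of_nat (Suc k + \<mu>) :: complex) powr of_nat m = of_nat (Suc k + \<mu>) ^ m"
      by (rule powr_nat') (simp only: of_nat_eq_0_iff, simp)
    then show ?thesis
      by (simp only: powr_minus inverse_eq_divide)
  qed
  then show ?thesis
    by (simp only: D_def of_nat_add[symmetric]) simp
qed

theorem theorem2p6:
  fixes n m \<mu> :: nat
  assumes "n \<ge> 1" and "m \<ge> 1"
  shows "D (of_nat n) (- of_nat m) (of_nat \<mu>) =
           (\<Sum>l=0..m. of_nat (m choose l) * (of_nat \<mu> - of_nat n) ^ (m - l)
                        * D 1 (- of_nat l) 1)
           - (\<Sum>k=2..n. (zeta (of_nat k) - 1) * (of_nat k + of_nat \<mu> - of_nat n) ^ m)"
proof -
  define a where "a k = zeta (of_nat (k + 2)) - 1" for k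
  define c where "c l = of_nat (m choose l) * (of_nat \<mu> - of_nat n :: complex) ^ (m - l)" for l
  define g where "g k = a k * (of_nat (k + 2) + of_nat \<mu> - of_nat n) ^ m" for k
  have summable_a: "summable (\<lambda>k. a k * of_nat (k + 2) ^ l)" for l
    unfolding a_def by (rule summable_zeta_moments)
  \<comment> \<open>With \<open>n = \<mu> = 1\<close> the zeta argument and the base are both
    \<open>k + 2\<close>.\<close>
  have D_1: "D 1 (- of_nat l) 1 = (\<Sum>k. a k * of_nat (k + 2) ^ l)" for l
    using D_neg_of_nat[of 1 l 1] by (simp add: a_def)
  have g_eq: "g k = (\<Sum>l=0..m. c l * (a k * of_nat (k + 2) ^ l))" for k
    unfolding g_def c_def add_diff_eq[symmetric] binomial_ring
    by (simp add: sum_distrib_left atMost_atLeast0 mult_ac)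
  have g_sums: "g sums (\<Sum>l=0..m. c l * D 1 (- of_nat l) 1)"
    unfolding g_eq[abs_def] D_1
    by (intro sums_sum sums_mult summable_sums summable_a)
  \<comment> \<open>Since \<open>n \<ge> 1\<close>, the zeta argument \<open>n + Suc k\<close> is
    \<open>(k + (n - 1)) + 2\<close>, and subtracting \<open>n\<close> after adding
    \<open>\<mu>\<close> leaves the base \<open>Suc k + \<mu>\<close>.\<close>
  have "D (of_nat n) (- of_nat m) (of_nat \<mu>) = (\<Sum>k. g (k + (n - 1)))"
    unfolding D_neg_of_nat g_def a_def using assms(1)
    by (intro suminf_cong) (simp add: of_nat_diff algebra_simps)
  also have "\<dots> = (\<Sum>k. g k) - (\<Sum>k<n - 1. g k)"
    by (rule suminf_minus_initial_segment[OF sums_summable[OF g_sums]])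
  \<comment> \<open>The shift by 2 carries \<open>k < n - 1\<close> onto \<open>2..n\<close>; both
    are empty for \<open>n = 1\<close>.\<close>
  also have "(\<Sum>k<n - 1. g k) =
      (\<Sum>k=2..n. (zeta (of_nat k) - 1) * (of_nat k + of_nat \<mu> - of_nat n) ^ m)"
    by (rule sum.reindex_bij_witness[of _ "\<lambda>k. k - 2" "\<lambda>k. k + 2"])
      (use assms(1) in \<open>auto simp: g_def a_def\<close>)
  finally show ?thesis
    using sums_unique[OF g_sums] by (simp add: c_def)
qed

end
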